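(* Let $H$ be a graph, possibly with loops, and let $G$ be an $H$-colored complete graph of order $n$ with $n\ge 3$, such that for every $x\in V(G)$ the graph $G_x$ is a complete $k_x$-partite graph for some $k_x\in\mathbb{N}$. Suppose that (1) for every $x\in V(G)$, $k_x\ge \frac{n+1}{2}$, and (2) $G$ does not contain a cycle of length $4$ with exactly $3$ obstructions. Then each vertex of $G$ is contained in an $H$-cycle of length $3$.
   Context: All graphs are finite; $G$ is simple. An $H$-coloring of $G$ is a function $c:E(G)\to V(H)$; $G$ is then called $H$-colored. A cycle $(v_1,\dots,v_k,v_1)$ of $G$ is an $H$-cycle if $(c(v_1v_2),\dots,c(v_{k-1}v_k),c(v_kv_1),c(v_1v_2))$ is a walk in $H$ (consecutive colors must be adjacent in $H$, where a loop at a color allows that color to be repeated). For a vertex $x$ of $G$, $G_x$ is the graph whose vertex set is the set of edges of $G$ incident with $x$, two distinct such edges $a,b$ being adjacent in $G_x$ iff $c(a)c(b)\in E(H)$. A complete $k$-partite graph is one whose vertex set is partitioned into $k$ nonempty independent sets with all edges between distinct parts present. For a closed walk/cycle $(x_1,\dots,x_{m},x_1)$, a vertex $x_i$ is an obstruction of it if $c(x_{i-1}x_i)c(x_ix_{i+1})\notin E(H)$ (indices modulo $m$; in particular $x_1$ is an obstruction iff $c(x_mx_1)c(x_1x_2)\notin E(H)$). *)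

theory Defs
  imports Complex_Main "HOL-Library.Disjoint_Sets"
begin

text \<open>An undirected graph has edges \<open>{u, v}\<close>; a loop at \<open>u\<close> is the singleton edge \<open>{u}\<close>.\<close>

record 'a ugraph =
  verts :: "'a set"
  edges :: "'a set set"

definition graph_with_loops :: "'a ugraph \<Rightarrow> bool" where
  "graph_with_loops H \<longleftrightarrow>
     finite (verts H) \<and> (\<forall>e\<in>edges H. \<exists>u\<in>verts H. \<exists>v\<in>verts H. e = {u, v})"

definition simple_graph :: "'a ugraph \<Rightarrow> bool" where
  "simple_graph G \<longleftrightarrow>
     finite (verts G) \<and> (\<forall>e\<in>edges G. \<exists>u\<in>verts G. \<exists>v\<in>verts G. u \<noteq> v \<and> e = {u, v})"

definition adj :: "'a ugraph \<Rightarrow> 'a \<Rightarrow> 'a \<Rightarrow> bool" where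
  "adj G u v \<longleftrightarrow> {u, v} \<in> edges G"

definition complete_graph :: "'a ugraph \<Rightarrow> bool" where
  "complete_graph G \<longleftrightarrow>
     simple_graph G \<and> (\<forall>u\<in>verts G. \<forall>v\<in>verts G. u \<noteq> v \<longrightarrow> adj G u v)"

definition independent_set :: "'a ugraph \<Rightarrow> 'a set \<Rightarrow> bool" where
  "independent_set G S \<longleftrightarrow> S \<subseteq> verts G \<and> (\<forall>u\<in>S. \<forall>v\<in>S. \<not> adj G u v)"

text \<open>The predicate \<open>partition_on\<close> includes that all parts are nonempty.\<close>

definition complete_partite :: "nat \<Rightarrow> 'a ugraph \<Rightarrow> bool" where
  "complete_partite k G \<longleftrightarrow>
     simple_graph G \<and>
     (\<exists>P. partition_on (verts G) P \<and> card P = k \<and>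
          (\<forall>A\<in>P. independent_set G A) \<and>
          (\<forall>A\<in>P. \<forall>B\<in>P. A \<noteq> B \<longrightarrow> (\<forall>u\<in>A. \<forall>v\<in>B. adj G u v)))"

definition walk :: "'a ugraph \<Rightarrow> 'a list \<Rightarrow> bool" where
  "walk G xs \<longleftrightarrow> xs \<noteq> [] \<and> set xs \<subseteq> verts G \<and> successively (adj G) xs"

text \<open>The list \<open>[v\<^sub>1, \<dots>, v\<^sub>k]\<close> represents the cycle \<open>(v\<^sub>1, \<dots>, v\<^sub>k, v\<^sub>1)\<close>.\<close>

definition cycle :: "'a ugraph \<Rightarrow> 'a list \<Rightarrow> bool" where
  "cycle G vs \<longleftrightarrow> 3 \<le> length vs \<and> distinct vs \<and> walk G (vs @ [hd vs])"

definition edge_coloring :: "'b ugraph \<Rightarrow> 'a ugraph \<Rightarrow> ('a set \<Rightarrow> 'b) \<Rightarrow> bool" where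
  "edge_coloring H G c \<longleftrightarrow> (\<forall>e\<in>edges G. c e \<in> verts H)"

text \<open>
  The edge leaving the \<open>i\<close>-th vertex of the cycle represented by \<open>vs\<close>; positions are counted
  from \<open>0\<close> and taken modulo the length, so position \<open>i + length vs - 1\<close> precedes position \<open>i\<close>.
\<close>

definition cycle_edge :: "'a list \<Rightarrow> nat \<Rightarrow> 'a set" where
  "cycle_edge vs i = {vs ! (i mod length vs), vs ! (Suc i mod length vs)}"

definition cycle_colors :: "('a set \<Rightarrow> 'b) \<Rightarrow> 'a list \<Rightarrow> 'b list" where
  "cycle_colors c vs = map (\<lambda>i. c (cycle_edge vs i)) [0..<length vs]"

definition H_cycle :: "'b ugraph \<Rightarrow> 'a ugraph \<Rightarrow> ('a set \<Rightarrow> 'b) \<Rightarrow> 'a list \<Rightarrow> bool" where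
  "H_cycle H G c vs \<longleftrightarrow>
     cycle G vs \<and> walk H (cycle_colors c vs @ [hd (cycle_colors c vs)])"

definition obstructions :: "'b ugraph \<Rightarrow> ('a set \<Rightarrow> 'b) \<Rightarrow> 'a list \<Rightarrow> 'a set" where
  "obstructions H c vs =
     {vs ! i | i. i < length vs \<and>
        \<not> adj H (c (cycle_edge vs (i + length vs - 1))) (c (cycle_edge vs i))}"

definition edge_graph_at ::
  "'b ugraph \<Rightarrow> 'a ugraph \<Rightarrow> ('a set \<Rightarrow> 'b) \<Rightarrow> 'a \<Rightarrow> 'a set ugraph" where
  "edge_graph_at H G c x =
     \<lparr>verts = {e \<in> edges G. x \<in> e},
      edges = {{a, b} | a b. a \<in> edges G \<and> x \<in> a \<and> b \<in> edges G \<and> x \<in> b \<and>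
                             a \<noteq> b \<and> adj H (c a) (c b)}\<rparr>"

end

theory Submission
  imports Defs
begin

text \<open>
  For a vertex \<open>x\<close>, identify an edge \<open>xy\<close> with its other end \<open>y\<close>, so that the
  parts of \<open>G\<^sub>x\<close> partition the vertices other than \<open>x\<close>; write \<open>y \<sim>\<^sub>x z\<close> if
  \<open>y\<close> and \<open>z\<close> lie in one part, i.e. if passing \<open>y, x, z\<close> is an obstruction at \<open>x\<close>. Suppose that no
  triangle through \<open>v\<close> is free of obstructions, and let \<open>S\<close> be the set of vertices forming a
  singleton part at \<open>v\<close>. Counting gives \<open>|S| \<ge> 2 k\<^sub>v - n + 1\<close>. The digraph \<open>y \<rightarrow> z\<close> iff \<open>v \<sim>\<^sub>y z\<close>
  joins any two vertices in different parts at \<open>v\<close>, so some \<open>z\<close> in \<open>S\<close> has at least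
  \<open>(|S| - 1) / 2\<close> out-neighbours in \<open>S\<close>. Every vertex outside the part of \<open>v\<close> at \<open>z\<close> is an
  in-neighbour of \<open>z\<close>, and the 4-cycles \<open>(v, y, z, w, v)\<close> show that in-neighbours \<open>y\<close>, \<open>w\<close> with
  \<open>y \<sim>\<^sub>v w\<close> satisfy \<open>y \<sim>\<^sub>z w\<close>. Hence the other parts at \<open>z\<close> inject into the parts at \<open>v\<close>
  distinct from \<open>{z}\<close> and from the singletons of the out-neighbours, so that
  \<open>k\<^sub>z \<le> k\<^sub>v - (|S| - 1) / 2 \<le> n / 2\<close>, a contradiction.
\<close>

section \<open>Counting in digraphs and set partitions\<close>

definition same_part :: "'a set set \<Rightarrow> 'a \<Rightarrow> 'a \<Rightarrow> bool" where
  "same_part P y z \<longleftrightarrow> (\<exists>A\<in>P. y \<in> A \<and> z \<in> A)"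

lemma same_part_commute: "same_part P y z \<longleftrightarrow> same_part P z y"
  by (auto simp: same_part_def)

text \<open>Out-degrees and in-degrees have equal sums over \<open>S\<close>, and at each vertex the
  two add up to at least \<open>card S - 1\<close>. Hence the average out-degree is at least half of
  that.\<close>

lemma semicomplete_digraph_large_out_degree:
  assumes "finite S" "S \<noteq> {}"
    and total: "\<And>y z. y \<in> S \<Longrightarrow> z \<in> S \<Longrightarrow> y \<noteq> z \<Longrightarrow> T y z \<or> T z y"
  shows "\<exists>z\<in>S. card S \<le> 2 * card {w \<in> S. w \<noteq> z \<and> T z w} + 1"
proof (rule ccontr)
  assume "\<not> ?thesis"
  then have small: "2 * card {w \<in> S. w \<noteq> z \<and> T z w} + 1 < card S" if "z \<in> S" for z
    using that by (auto simp: not_le)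
  have swap: "(\<Sum>z\<in>S. card {w \<in> S. w \<noteq> z \<and> T z w}) = (\<Sum>z\<in>S. card {w \<in> S. w \<noteq> z \<and> T w z})"
  proof -
    have "(\<Sum>z\<in>S. card {w \<in> S. w \<noteq> z \<and> T z w}) = (\<Sum>z\<in>S. \<Sum>w\<in>S. if w \<noteq> z \<and> T z w then 1 else 0)"
      using assms(1) by (simp add: sum.If_cases Int_def)
    also have "\<dots> = (\<Sum>w\<in>S. \<Sum>z\<in>S. if w \<noteq> z \<and> T z w then 1 else 0)"
      by (rule sum.swap)
    also have "\<dots> = (\<Sum>w\<in>S. \<Sum>z\<in>S. if z \<noteq> w \<and> T z w then 1 else 0)"
      by (simp add: eq_commute)
    also have "\<dots> = (\<Sum>z\<in>S. card {w \<in> S. w \<noteq> z \<and> T w z})"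
      using assms(1) by (simp add: sum.If_cases Int_def)
    finally show ?thesis .
  qed
  have deg: "card S \<le> card {w \<in> S. w \<noteq> z \<and> T z w} + card {w \<in> S. w \<noteq> z \<and> T w z} + 1"
    if "z \<in> S" for z
  proof -
    have "S - {z} \<subseteq> {w \<in> S. w \<noteq> z \<and> T z w} \<union> {w \<in> S. w \<noteq> z \<and> T w z}"
      using total that by blast
    then have "card (S - {z}) \<le> card ({w \<in> S. w \<noteq> z \<and> T z w} \<union> {w \<in> S. w \<noteq> z \<and> T w z})"
      using assms(1) by (intro card_mono) auto
    also have "\<dots> \<le> card {w \<in> S. w \<noteq> z \<and> T z w} + card {w \<in> S. w \<noteq> z \<and> T w z}"
      by (rule card_Un_le)
    finally show ?thesis using that assms(1) by simp
  qed
  have "(\<Sum>z\<in>S. card S) \<le> (\<Sum>z\<in>S. card {w \<in> S. w \<noteq> z \<and> T z w} + card {w \<in> S. w \<noteq> z \<and> T w z} + 1)"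
    by (rule sum_mono) (use deg in auto)
  also have "\<dots> = (\<Sum>z\<in>S. 2 * card {w \<in> S. w \<noteq> z \<and> T z w} + 1)"
    by (simp only: sum.distrib mult_2 swap)
  also have "\<dots> < (\<Sum>z\<in>S. card S)"
    by (rule sum_strict_mono) (use assms small in auto)
  finally show False by simp
qed

text \<open>A part that is no singleton has at least two elements, so after crediting each singleton
  with one extra every part counts for at least 2.\<close>

lemma partition_on_many_singletons:
  assumes "finite X" "partition_on X P"
  shows "2 * card P \<le> card X + card {z. {z} \<in> P}"
proof -
  have finP: "finite P"
    using assms by (rule finite_elements)
  have fin: "finite A" "A \<noteq> {}" if "A \<in> P" for A
    using assms that partition_onD1[of X P] partition_onD3[of X P] by (auto intro: finite_subset)
  have pos: "card A > 0" if "A \<in> P" for A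
    using fin[OF that] by (simp add: card_gt_0_iff)
  have "{A \<in> P. card A = 1} = (\<lambda>z. {z}) ` {z. {z} \<in> P}"
    by (auto simp: card_1_singleton_iff)
  then have singletons: "card {A \<in> P. card A = 1} = card {z. {z} \<in> P}"
    by (simp add: card_image)
  have "2 * card P = (\<Sum>A\<in>P. 2)" by simp
  also have "\<dots> \<le> (\<Sum>A\<in>P. card A + (if card A = 1 then 1 else 0))"
    by (rule sum_mono) (use pos in \<open>fastforce simp: Suc_le_eq le_less\<close>)
  also have "\<dots> = (\<Sum>A\<in>P. card A) + card {A \<in> P. card A = 1}"
    using finP by (simp add: sum.distrib sum.If_cases Int_def)
  also have "(\<Sum>A\<in>P. card A) = card (\<Union>P)"
    using card_Union_disjoint[of P] partition_onD2[OF assms(2)] fin(1) by simp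
  also have "\<Union>P = X"
    using assms partition_onD1 by blast
  finally show ?thesis using singletons by simp
qed

section \<open>The combinatorial core, in terms of partitions only\<close>

text \<open>\<open>Q x\<close> stands for the parts at \<open>x\<close>, and \<open>quad\<close> is
  the form in which the condition on 4-cycles enters.\<close>

lemma obstruction_free_triangle_exists:
  fixes Q :: "'a \<Rightarrow> 'a set set"
  assumes "finite V" and "v \<in> V"
    and parts: "\<And>x. x \<in> V \<Longrightarrow> partition_on (V - {x}) (Q x)"
    and many: "\<And>x. x \<in> V \<Longrightarrow> card V + 1 \<le> 2 * card (Q x)"
    and quad: "\<And>y z w. {y, z, w} \<subseteq> V - {v} \<Longrightarrow> distinct [y, z, w] \<Longrightarrow> same_part (Q v) y w \<Longrightarrow>
      same_part (Q y) v z \<Longrightarrow> same_part (Q w) v z \<Longrightarrow> same_part (Q z) y w"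
  obtains y z where "y \<in> V - {v}" "z \<in> V - {v}" "y \<noteq> z"
    "\<not> same_part (Q v) y z" "\<not> same_part (Q y) v z" "\<not> same_part (Q z) v y"
proof (rule ccontr)
  assume "\<not> thesis"
  with that have arc: "same_part (Q y) v z \<or> same_part (Q z) v y"
    if "y \<in> V - {v}" "z \<in> V - {v}" "y \<noteq> z" "\<not> same_part (Q v) y z" for y z
    using that by blast
  have finQ: "finite (Q x)" if "x \<in> V" for x
    using parts[OF that] assms(1) finite_elements by blast
  have part_unique: "A = B" if "x \<in> V" "A \<in> Q x" "B \<in> Q x" "a \<in> A" "a \<in> B" for x a A B
    using parts[OF that(1)] that(2-) partition_onD2 by (fastforce simp: disjoint_def)
  have in_part: "\<exists>A\<in>Q x. a \<in> A" if "x \<in> V" "a \<in> V" "a \<noteq> x" for x a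
    using partition_onD1[OF parts[OF that(1)]] that by blast
  have part_sub: "a \<in> V - {x}" if "x \<in> V" "A \<in> Q x" "a \<in> A" for x a A
    using partition_onD1[OF parts[OF that(1)]] that by blast
  have nonempty: "A \<noteq> {}" if "x \<in> V" "A \<in> Q x" for x A
    using partition_onD3[OF parts[OF that(1)]] that by blast
  define S where "S = {z. {z} \<in> Q v}"
  have S_sub: "S \<subseteq> V - {v}"
    using part_sub[OF \<open>v \<in> V\<close>] by (auto simp: S_def)
  then have finS: "finite S"
    using assms(1) finite_subset by blast
  have singleton: "y = z" if "z \<in> S" "same_part (Q v) y z" for y z
    using that part_unique[OF \<open>v \<in> V\<close>, of "{z}"] by (auto simp: S_def same_part_def)
  have "2 * card (Q v) \<le> card (V - {v}) + card S"
    unfolding S_def by (rule partition_on_many_singletons) (use assms in auto)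
  moreover have "card (V - {v}) + 1 = card V"
    using assms(1,2) by (metis Suc_eq_plus1 card_Suc_Diff1)
  ultimately have cardS: "2 * card (Q v) + 1 \<le> card V + card S"
    by simp
  \<comment> \<open>Together the two bounds even give two singletons.\<close>
  with many[OF \<open>v \<in> V\<close>] have "S \<noteq> {}" by auto
  \<comment> \<open>Distinct members of \<open>S\<close> lie in different parts at \<open>v\<close>,
    so \<open>arc\<close> makes the digraph semicomplete on \<open>S\<close>.\<close>
  then obtain z where z: "z \<in> S"
    and deg: "card S \<le> 2 * card {w \<in> S. w \<noteq> z \<and> same_part (Q z) v w} + 1"
    using semicomplete_digraph_large_out_degree[OF finS, of "\<lambda>y. same_part (Q y) v"]
      arc S_sub singleton by (metis subsetD)
  define N where "N = {w \<in> S. w \<noteq> z \<and> same_part (Q z) v w}"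
  have zV: "z \<in> V" "z \<noteq> v" using z S_sub by auto
  obtain C where C: "C \<in> Q z" "v \<in> C"
    using in_part[of z v] zV \<open>v \<in> V\<close> by auto
  \<comment> \<open>As \<open>{z}\<close> is a part at \<open>v\<close>, \<open>arc\<close> applies
    to \<open>y\<close> and \<open>z\<close>. Outside \<open>C\<close> the arc from \<open>z\<close>
    to \<open>y\<close> is missing, so the one from \<open>y\<close> to \<open>z\<close> is
    present.\<close>
  have in_neighbour: "y \<in> V - {v}" "y \<noteq> z" "\<not> same_part (Q z) v y" "same_part (Q y) v z"
    if "A \<in> Q z - {C}" "y \<in> A" for A y
  proof -
    have yV: "y \<in> V - {z}"
      using part_sub[OF zV(1)] that by blast
    show "y \<noteq> z" using yV by simp
    show not_same: "\<not> same_part (Q z) v y"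
    proof
      assume "same_part (Q z) v y"
      then obtain B where "B \<in> Q z" "v \<in> B" "y \<in> B"
        by (auto simp: same_part_def)
      then show False
        using part_unique[OF zV(1)] C that by (metis DiffE singletonI)
    qed
    show "y \<in> V - {v}"
      using yV not_same C by (auto simp: same_part_def)
    then show "same_part (Q y) v z"
      using arc[of y z] not_same zV yV singleton[OF z] by blast
  qed
  have "\<exists>B\<in>Q v. \<exists>a\<in>A. a \<in> B" if "A \<in> Q z - {C}" for A
    using nonempty[OF zV(1), of A] in_neighbour[OF that] in_part[OF \<open>v \<in> V\<close>] that by blast
  \<comment> \<open>\<open>f A\<close> is any part at \<open>v\<close> that meets \<open>A\<close>;
    neither set need contain the other.\<close>
  then obtain f where f: "f A \<in> Q v" "\<exists>a\<in>A. a \<in> f A" if "A \<in> Q z - {C}" for A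
    by metis
  have "inj_on f (Q z - {C})"
  proof (rule inj_onI)
    fix A A' assume A: "A \<in> Q z - {C}" "A' \<in> Q z - {C}" "f A = f A'"
    then obtain a a' where a: "a \<in> A" "a \<in> f A" "a' \<in> A'" "a' \<in> f A"
      using f(2) by metis
    then have v: "same_part (Q v) a a'"
      using f(1) A by (auto simp: same_part_def)
    show "A = A'"
    proof (cases "a = a'")
      case True
      then show ?thesis using part_unique[OF zV(1)] A a by blast
    next
      \<comment> \<open>Both \<open>a\<close> and \<open>a'\<close> are in-neighbours of
        \<open>z\<close> in one part at \<open>v\<close>, as \<open>quad\<close> demands.\<close>
      case False
      then have "same_part (Q z) a a'"
        using quad[of a z a'] v in_neighbour[OF A(1) a(1)] in_neighbour[OF A(2) a(3)] zV by auto
      then obtain D where "D \<in> Q z" "a \<in> D" "a' \<in> D"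
        by (auto simp: same_part_def)
      then show ?thesis
        using part_unique[OF zV(1)] A a by (metis DiffD1)
    qed
  qed
  \<comment> \<open>\<open>f A\<close> contains an element of \<open>A\<close>, which is neither
    \<open>z\<close> nor in \<open>N\<close>, so \<open>f A\<close> is none of the removed
    singletons.\<close>
  moreover have "f ` (Q z - {C}) \<subseteq> Q v - (\<lambda>w. {w}) ` insert z N"
  proof (intro image_subsetI DiffI)
    fix A assume A: "A \<in> Q z - {C}"
    show "f A \<in> Q v" by (rule f(1)[OF A])
    obtain a where "a \<in> A" "a \<in> f A" using f(2)[OF A] by blast
    then show "f A \<notin> (\<lambda>w. {w}) ` insert z N"
      using in_neighbour[OF A \<open>a \<in> A\<close>] by (auto simp: N_def)
  qed
  ultimately have "card (Q z - {C}) \<le> card (Q v - (\<lambda>w. {w}) ` insert z N)"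
    using finQ[OF \<open>v \<in> V\<close>] by (intro card_inj_on_le) auto
  also have "\<dots> = card (Q v) - card (insert z N)"
  proof (subst card_Diff_subset)
    show "finite ((\<lambda>w. {w}) ` insert z N)"
      using finS by (simp add: N_def)
    show "(\<lambda>w. {w}) ` insert z N \<subseteq> Q v"
      using z by (auto simp: N_def S_def)
    show "card (Q v) - card ((\<lambda>w. {w}) ` insert z N) = card (Q v) - card (insert z N)"
      by (subst card_image) auto
  qed
  also have "card (insert z N) = card N + 1"
    using finS by (simp add: N_def)
  finally have *: "card (Q z) - 1 \<le> card (Q v) - (card N + 1)"
    using C finQ[OF zV(1)] by simp
  \<comment> \<open>This bound shows that the subtraction on the right of \<open>*\<close> is not
    truncated.\<close>
  have "card (insert z N) \<le> card (Q v)"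
    using z finQ[OF \<open>v \<in> V\<close>]
    by (intro card_inj_on_le[of "\<lambda>w. {w}"]) (auto simp: N_def S_def)
  then have "card N + 1 \<le> card (Q v)"
    using finS by (simp add: N_def)
  with * have "card (Q z) + card N \<le> card (Q v)"
    by linarith
  \<comment> \<open>With n = \<open>card V\<close>: 2 |Q z| + 2 |N| \<le> 2 |Q v| \<le> n + |S| - 1
    \<le> n + 2 |N|, against \<open>many\<close>.\<close>
  with deg cardS many[OF zV(1)] show False
    unfolding N_def by linarith
qed

section \<open>From colored edges to partitions of the vertices\<close>

lemma complete_graph_edges_at:
  assumes "complete_graph G" "x \<in> verts G"
  shows "{e \<in> edges G. x \<in> e} = (\<lambda>y. {x, y}) ` (verts G - {x})"
  using assms by (fastforce simp: complete_graph_def simple_graph_def adj_def doubleton_eq_iff)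

lemma adj_commute: "adj H a b \<longleftrightarrow> adj H b a"
  by (simp add: adj_def insert_commute)

text \<open>Edges are unordered, so the ends may come back swapped; symmetry of \<open>adj H\<close>
  absorbs this.\<close>

lemma adj_edge_graph_at:
  "adj (edge_graph_at H G c x) a b \<longleftrightarrow>
    a \<in> edges G \<and> x \<in> a \<and> b \<in> edges G \<and> x \<in> b \<and> a \<noteq> b \<and> adj H (c a) (c b)"
  (is "?l \<longleftrightarrow> ?r")
proof
  assume ?l
  then have "{a, b} \<in> edges (edge_graph_at H G c x)"
    by (simp add: adj_def)
  then obtain a' b' where "{a, b} = {a', b'}" "a' \<in> edges G" "x \<in> a'" "b' \<in> edges G" "x \<in> b'"
    "a' \<noteq> b'" "adj H (c a') (c b')"
    by (auto simp: edge_graph_at_def)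
  then show ?r
    by (metis adj_commute doubleton_eq_iff)
next
  assume ?r
  then have "{a, b} \<in> edges (edge_graph_at H G c x)"
    by (auto simp: edge_graph_at_def)
  then show ?l
    by (simp add: adj_def)
qed

text \<open>Parts are carried over along the bijection between the edges at \<open>x\<close> and
  their other ends. The case \<open>y = z\<close> is excluded because a color may have a
  loop.\<close>

lemma complete_partite_edge_graph_at_partition:
  assumes G: "complete_graph G" "x \<in> verts G"
    and "complete_partite k (edge_graph_at H G c x)"
  obtains Q where "partition_on (verts G - {x}) Q" "card Q = k"
    "\<And>y z. y \<in> verts G - {x} \<Longrightarrow> z \<in> verts G - {x} \<Longrightarrow> y \<noteq> z \<Longrightarrow>
      adj H (c {x, y}) (c {x, z}) \<longleftrightarrow> \<not> same_part Q y z"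
proof -
  let ?E = "{e \<in> edges G. x \<in> e}" and ?X = "verts G - {x}" and ?h = "\<lambda>y. {x, y}"
  obtain P where P: "partition_on ?E P" "card P = k"
    and indep: "\<And>A. A \<in> P \<Longrightarrow> independent_set (edge_graph_at H G c x) A"
    and joined: "\<And>A B a b. A \<in> P \<Longrightarrow> B \<in> P \<Longrightarrow> A \<noteq> B \<Longrightarrow> a \<in> A \<Longrightarrow> b \<in> B \<Longrightarrow>
      adj (edge_graph_at H G c x) a b"
    using assms(3) unfolding complete_partite_def by (auto simp: edge_graph_at_def)
  have E: "?E = ?h ` ?X"
    by (rule complete_graph_edges_at[OF G])
  have inj: "inj_on ?h ?X"
    by (auto simp: inj_on_def doubleton_eq_iff)
  define g where "g = the_inv_into ?X ?h"
  have g: "g {x, y} = y" if "y \<in> ?X" for y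
    unfolding g_def using the_inv_into_f_f[OF inj that] .
  have bij: "bij_betw g ?E ?X"
    unfolding g_def E by (intro bij_betw_the_inv_into bij_betw_imageI inj refl)
  have sub: "A \<subseteq> ?E" if "A \<in> P" for A
    using P(1) that partition_onD1 by blast
  have inj_g: "inj_on ((`) g) P"
    using bij sub by (intro inj_on_image) (metis P(1) bij_betw_imp_inj_on partition_onD1)
  have "partition_on ?X ((`) g ` P)"
  proof -
    have "partition_on (g ` ?E) ((`) g ` P - {{}})"
      using partition_on_inj_image[OF P(1) bij_betw_imp_inj_on[OF bij]] .
    moreover have "{} \<notin> (`) g ` P"
      using partition_onD3[OF P(1)] by auto
    ultimately show ?thesis
      using bij_betw_imp_surj_on[OF bij] by simp
  qed
  moreover have "card ((`) g ` P) = k"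
    using inj_g P(2) by (simp add: card_image)
  moreover have "adj H (c {x, y}) (c {x, z}) \<longleftrightarrow> \<not> same_part ((`) g ` P) y z"
    if yz: "y \<in> ?X" "z \<in> ?X" "y \<noteq> z" for y z
  proof -
    have edges: "{x, y} \<in> ?E" "{x, z} \<in> ?E"
      using E yz by auto
    have ne: "{x, y} \<noteq> {x, z}"
      using yz by (auto simp: doubleton_eq_iff)
    have mem: "w \<in> g ` A \<longleftrightarrow> {x, w} \<in> A" if "A \<in> P" "w \<in> ?X" for A w
    proof
      assume "w \<in> g ` A"
      then obtain e where e: "e \<in> A" "w = g e" by blast
      with sub[OF that(1)] E obtain u where "u \<in> ?X" "e = {x, u}" by blast
      with e g show "{x, w} \<in> A" by metis
    next
      assume "{x, w} \<in> A"
      then show "w \<in> g ` A" using g[OF that(2)] by (metis imageI)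
    qed
    have "{x, y} \<in> \<Union>P" "{x, z} \<in> \<Union>P"
      using edges by (simp_all only: partition_onD1[OF P(1)])
    then obtain A B where AB: "A \<in> P" "{x, y} \<in> A" "B \<in> P" "{x, z} \<in> B"
      by (elim UnionE)
    have "adj H (c {x, y}) (c {x, z}) \<longleftrightarrow> adj (edge_graph_at H G c x) {x, y} {x, z}"
      using edges ne by (simp add: adj_edge_graph_at)
    also have "\<dots> \<longleftrightarrow> \<not> (\<exists>A\<in>P. {x, y} \<in> A \<and> {x, z} \<in> A)"
    proof
      assume "adj (edge_graph_at H G c x) {x, y} {x, z}"
      then show "\<not> (\<exists>A\<in>P. {x, y} \<in> A \<and> {x, z} \<in> A)"
        using indep unfolding independent_set_def by blast
    next
      assume "\<not> (\<exists>A\<in>P. {x, y} \<in> A \<and> {x, z} \<in> A)"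
      then show "adj (edge_graph_at H G c x) {x, y} {x, z}"
        using joined[OF AB(1,3) _ AB(2,4)] AB by blast
    qed
    also have "\<dots> \<longleftrightarrow> \<not> same_part ((`) g ` P) y z"
      using mem yz by (auto simp: same_part_def)
    finally show ?thesis .
  qed
  ultimately show thesis by (rule that)
qed

lemma complete_graph_cycle:
  assumes "complete_graph G" "set vs \<subseteq> verts G" "distinct vs" "length vs \<ge> 3"
  shows "cycle G vs"
proof -
  have "vs \<noteq> []"
    using assms(4) by auto
  then have hd: "hd vs = vs ! 0" "hd vs \<in> set vs"
    by (simp_all add: hd_conv_nth)
  have "successively (adj G) (vs @ [hd vs])"
    unfolding successively_conv_nth
  proof (intro allI impI)
    fix i assume i: "Suc i < length (vs @ [hd vs])"
    let ?w = "vs @ [hd vs]"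
    have "?w ! i \<noteq> ?w ! Suc i"
    proof (cases "Suc i = length vs")
      \<comment> \<open>The closing step, from the last vertex back to the first.\<close>
      case True
      then show ?thesis
        using assms(3,4) hd(1) nth_eq_iff_index_eq[of vs i 0]
        by (simp add: nth_append flip: length_greater_0_conv)
    next
      case False
      then show ?thesis
        using i assms(3) by (auto simp: nth_append nth_eq_iff_index_eq)
    qed
    moreover have "?w ! i \<in> set ?w" "?w ! Suc i \<in> set ?w"
      using i nth_mem[of _ ?w] by auto
    moreover have "set ?w \<subseteq> verts G"
      using assms(2) hd(2) by auto
    ultimately show "adj G (?w ! i) (?w ! Suc i)"
      using assms(1) unfolding complete_graph_def by blast
  qed
  then show ?thesis
    using assms hd(2) by (auto simp: cycle_def walk_def)
qed

section \<open>Reading 4-cycles and triangles off the partitions\<close>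

theorem theorem2:
  fixes H :: "'b ugraph" and G :: "'a ugraph" and c :: "'a set \<Rightarrow> 'b"
    and n :: nat and k :: "'a \<Rightarrow> nat"
  assumes "graph_with_loops H"
    and "complete_graph G" and "card (verts G) = n" and "n \<ge> 3"
    and "edge_coloring H G c"
    and "\<forall>x\<in>verts G. complete_partite (k x) (edge_graph_at H G c x)"
    and "\<forall>x\<in>verts G. real (k x) \<ge> (real n + 1) / 2"
    and "\<not> (\<exists>vs. cycle G vs \<and> length vs = 4 \<and> card (obstructions H c vs) = 3)"
  shows "\<forall>v\<in>verts G. \<exists>vs. H_cycle H G c vs \<and> length vs = 3 \<and> v \<in> set vs"
proof
  fix v assume v: "v \<in> verts G"
  let ?V = "verts G"
  have "\<forall>x\<in>?V. \<exists>Q. partition_on (?V - {x}) Q \<and> card Q = k x \<and>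
      (\<forall>y\<in>?V - {x}. \<forall>z\<in>?V - {x}. y \<noteq> z \<longrightarrow>
        (adj H (c {x, y}) (c {x, z}) \<longleftrightarrow> \<not> same_part Q y z))"
    using complete_partite_edge_graph_at_partition[OF assms(2)] assms(6) by metis
  then obtain Q where Q: "\<And>x. x \<in> ?V \<Longrightarrow> partition_on (?V - {x}) (Q x)"
      "\<And>x. x \<in> ?V \<Longrightarrow> card (Q x) = k x"
    and adj: "\<And>x y z. {x, y, z} \<subseteq> ?V \<Longrightarrow> distinct [x, y, z] \<Longrightarrow>
        adj H (c {x, y}) (c {x, z}) \<longleftrightarrow> \<not> same_part (Q x) y z"
    by (auto dest!: bchoice)
  have fin: "finite ?V"
    using assms(2) by (simp add: complete_graph_def simple_graph_def)
  have many: "card ?V + 1 \<le> 2 * card (Q x)" if "x \<in> ?V" for x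
  proof -
    have "real (card ?V + 1) \<le> real (2 * card (Q x))"
      using bspec[OF assms(7) that] Q(2)[OF that] assms(3) by simp
    then show ?thesis by (simp only: of_nat_le_iff)
  qed
  \<comment> \<open>Otherwise the 4-cycle through \<open>v\<close>, \<open>y\<close>,
    \<open>z\<close>, \<open>w\<close> has obstructions at every vertex except
    \<open>z\<close>.\<close>
  have quad: "same_part (Q z) y w"
    if yzw: "{y, z, w} \<subseteq> ?V - {v}" "distinct [y, z, w]"
      and obs: "same_part (Q v) y w" "same_part (Q y) v z" "same_part (Q w) v z" for y z w
  proof (rule ccontr)
    assume no_obs: "\<not> same_part (Q z) y w"
    let ?vs = "[v, y, z, w]"
    have "\<not> adj H (c {w, v}) (c {v, y})" "\<not> adj H (c {v, y}) (c {y, z})"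
      "adj H (c {y, z}) (c {z, w})" "\<not> adj H (c {z, w}) (c {w, v})"
      using adj[of v w y] adj[of y v z] adj[of z y w] adj[of w z v] yzw v obs no_obs
      by (auto simp: insert_commute same_part_commute)
    \<comment> \<open>Modulo 4, position \<open>i + 3\<close> is the one before
      \<open>i\<close>.\<close>
    moreover have "obstructions H c ?vs =
        (!) ?vs ` {i \<in> {0, 1, 2, 3}. \<not> adj H (c (cycle_edge ?vs (i + 3))) (c (cycle_edge ?vs i))}"
    proof -
      have "i < length ?vs \<longleftrightarrow> i \<in> {0, 1, 2, 3}" "i + length ?vs - 1 = i + 3" for i
        by auto
      then show ?thesis
        unfolding obstructions_def by (simp only: setcompr_eq_image)
    qed
    moreover have "cycle_edge ?vs 0 = {v, y}" "cycle_edge ?vs 1 = {y, z}" "cycle_edge ?vs 2 = {z, w}"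
      "cycle_edge ?vs 3 = {w, v}" "cycle_edge ?vs (0 + 3) = {w, v}" "cycle_edge ?vs (1 + 3) = {v, y}"
      "cycle_edge ?vs (2 + 3) = {y, z}" "cycle_edge ?vs (3 + 3) = {z, w}"
      by (simp_all add: cycle_edge_def)
    moreover have "{i \<in> {0, 1, 2, 3}. P i} = {0, 1, 3}" if "P 0" "P 1" "\<not> P 2" "P 3" for P :: "nat \<Rightarrow> bool"
      using that by auto
    ultimately have "obstructions H c ?vs = (!) ?vs ` {0, 1, 3}"
      by presburger
    then have "obstructions H c ?vs = {v, y, w}"
      by simp
    moreover have "card {v, y, w} = 3"
      using yzw by (auto simp: card_insert_if)
    ultimately have "card (obstructions H c ?vs) = 3"
      by (simp only:)
    moreover have "cycle G ?vs"
      using yzw v by (intro complete_graph_cycle[OF assms(2)]) auto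
    ultimately show False
      using assms(8) by (auto dest!: spec[of _ ?vs])
  qed
  obtain y z where yz: "y \<in> ?V - {v}" "z \<in> ?V - {v}" "y \<noteq> z"
    and no_obs: "\<not> same_part (Q v) y z" "\<not> same_part (Q y) v z" "\<not> same_part (Q z) v y"
    by (rule obstruction_free_triangle_exists[OF fin v Q(1) many quad])
  let ?vs = "[v, y, z]"
  have cyc: "cycle G ?vs"
    using yz v by (intro complete_graph_cycle[OF assms(2)]) auto
  have "adj H (c {v, y}) (c {y, z})" "adj H (c {y, z}) (c {z, v})" "adj H (c {z, v}) (c {v, y})"
    using adj[of y v z] adj[of z y v] adj[of v z y] yz v no_obs
    by (auto simp: insert_commute same_part_commute)
  \<comment> \<open>\<open>walk H\<close> also asks that the colors be vertices of
    \<open>H\<close>.\<close>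
  moreover have "c {v, y} \<in> verts H" "c {y, z} \<in> verts H" "c {z, v} \<in> verts H"
    using assms(2,5) yz v by (auto simp: complete_graph_def edge_coloring_def adj_def)
  moreover have "cycle_colors c ?vs = [c {v, y}, c {y, z}, c {z, v}]"
    by (simp add: cycle_colors_def cycle_edge_def upt_rec)
  ultimately have "H_cycle H G c ?vs"
    using cyc by (simp add: H_cycle_def walk_def)
  then show "\<exists>vs. H_cycle H G c vs \<and> length vs = 3 \<and> v \<in> set vs"
    by (intro exI[of _ ?vs]) simp
qed

end
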